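(* Let $(V,\omega)$ be a $2n$-dimensional real symplectic vector space and let $f$ and $g$ be positive-semidefinite quadratic forms on $V$, with associated symmetric bilinear forms $A,B$ and associated linear maps $F,G:V\to V$, such that the intersection $\mathrm{Rad}(A)\cap\mathrm{Rad}(B)$ of their radicals is a symplectic subspace. Then $f$ and $g$ Poisson commute, i.e. $\{f,g\}=0$, if and only if there exists a symplectic basis $\{x_1,\dots,x_n,y_1,\dots,y_n\}$ of $V$ such that $$Fx_j=-\mu_j y_j,\quad Fy_j=\mu_j x_j,\qquad Gx_j=-\gamma_j y_j,\quad Gy_j=\gamma_j x_j \qquad (1\le j\le n).$$ Here $\{\pm i\mu_1,\dots,\pm i\mu_k\}$ and $\{\pm i\gamma_1,\dots,\pm i\gamma_l\}$ are lists of all non-zero eigenvalues of $F$ and $G$ respectively, where $\mu_j>0$ for $1\le j\le k$ and $\gamma_j>0$ for $1\le j\le l$ and where each eigenvalue is repeated according to its multiplicity, and $\mu_j=0$ for $j>k$, $\gamma_j=0$ for $j>l$. For $v=\sum_{j=1}^n(s_jx_j+t_jy_j)\in V$ one has $$f(v)=\sum_{j=1}^{k}\mu_j(s_j^2+t_j^2),\qquad g(v)=\sum_{j=1}^{l}\gamma_j(s_j^2+t_j^2).$$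
   Context: For a quadratic form $f$ on $V$, $A$ is the unique symmetric bilinear form with $f(v)=A(v,v)$ for all $v\in V$, and $F:V\to V$ is the unique linear map with $A(v,w)=\omega(v,Fw)$ for all $v,w\in V$. Similarly, $B$ is the symmetric bilinear form of $g$, and $G:V\to V$ is the linear map with $B(v,w)=\omega(v,Gw)$. The forms $\omega,A,B$ extend complex-bilinearly, and $F,G$ complex-linearly, to the complexification $V^{\mathbb{C}}$; eigenvalues are taken there. The radical is $\mathrm{Rad}(A)=\{x\in V^{\mathbb{C}} : A(x,y)=0 \text{ for all } y\in V^{\mathbb{C}}\}=\mathrm{Ker}(F)$, and likewise $\mathrm{Rad}(B)=\mathrm{Ker}(G)$. A subspace $W$ is symplectic if $W\cap W^\omega=\{0\}$, where $W^\omega=\{x : \omega(x,y)=0 \text{ for all } y\in W\}$. A symplectic basis of $V$ is a basis $\{x_1,\dots,x_n,y_1,\dots,y_n\}$ with $\omega(x_j,y_j)=1$ for all $j$ and $\omega(x_i,y_j)=\omega(x_i,x_j)=\omega(y_i,y_j)=0$ for all $i\ne j$. The Poisson bracket of smooth functions on $V$ is the standard one, $\{f,g\}=\omega(X_f,X_g)$, where the Hamiltonian vector field $X_f$ is defined by $\omega(X_f,\cdot)=df$ (the overall sign convention is immaterial).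
   Formalization: The signs in the display are reversed (Fx_j = μ_j y_j, Fy_j = −μ_j x_j, same for G), as A(v,w)=ω(v,Fw) forces; the non-zero γ_j occupy an index set L of {1,…,n} instead of 1,…,l, since one basis cannot in general order both lists first. *)

theory Defs
  imports "HOL-Analysis.Analysis"
begin

definition symplectic_form :: "('v::real_vector \<Rightarrow> 'v \<Rightarrow> real) \<Rightarrow> bool" where
  "symplectic_form \<omega> \<longleftrightarrow>
     bilinear \<omega> \<and> (\<forall>x. \<omega> x x = 0) \<and> (\<forall>x. (\<forall>y. \<omega> x y = 0) \<longrightarrow> x = 0)"

(* f is a quadratic form precisely when such an A exists, and then A is unique. *)
definition assoc_bilinear_form ::
    "('v::real_vector \<Rightarrow> real) \<Rightarrow> ('v \<Rightarrow> 'v \<Rightarrow> real) \<Rightarrow> bool" where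
  "assoc_bilinear_form f A \<longleftrightarrow>
     bilinear A \<and> (\<forall>v w. A v w = A w v) \<and> (\<forall>v. f v = A v v)"

(* For a symplectic form and a bilinear A on a finite-dimensional space,
   exactly one F satisfies this. *)
definition assoc_linear_map ::
    "('v::real_vector \<Rightarrow> 'v \<Rightarrow> real) \<Rightarrow> ('v \<Rightarrow> 'v \<Rightarrow> real) \<Rightarrow> ('v \<Rightarrow> 'v) \<Rightarrow> bool" where
  "assoc_linear_map \<omega> A F \<longleftrightarrow> linear F \<and> (\<forall>v w. A v w = \<omega> v (F w))"

definition symplectic_basis ::
    "('v::real_vector \<Rightarrow> 'v \<Rightarrow> real) \<Rightarrow> nat \<Rightarrow> (nat \<Rightarrow> 'v) \<Rightarrow> (nat \<Rightarrow> 'v) \<Rightarrow> bool" where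
  "symplectic_basis \<omega> n x y \<longleftrightarrow>
     card (x ` {1..n} \<union> y ` {1..n}) = 2 * n \<and>
     independent (x ` {1..n} \<union> y ` {1..n}) \<and>
     span (x ` {1..n} \<union> y ` {1..n}) = UNIV \<and>
     (\<forall>j\<in>{1..n}. \<omega> (x j) (y j) = 1) \<and>
     (\<forall>i\<in>{1..n}. \<forall>j\<in>{1..n}. i \<noteq> j \<longrightarrow>
        \<omega> (x i) (y j) = 0 \<and> \<omega> (x i) (x j) = 0 \<and> \<omega> (y i) (y j) = 0)"

definition hamiltonian_vector_field ::
    "('v::real_normed_vector \<Rightarrow> 'v \<Rightarrow> real) \<Rightarrow> ('v \<Rightarrow> real) \<Rightarrow> 'v \<Rightarrow> 'v" where
  "hamiltonian_vector_field \<omega> f v =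
     (THE u. \<forall>w. \<omega> u w = frechet_derivative f (at v) w)"

definition poisson_bracket ::
    "('v::real_normed_vector \<Rightarrow> 'v \<Rightarrow> real) \<Rightarrow> ('v \<Rightarrow> real) \<Rightarrow> ('v \<Rightarrow> real) \<Rightarrow> 'v \<Rightarrow> real" where
  "poisson_bracket \<omega> f g =
     (\<lambda>v. \<omega> (hamiltonian_vector_field \<omega> f v) (hamiltonian_vector_field \<omega> g v))"

(* The complexification of 'v: the pair (a, b) stands for a + i b, with the componentwise
   addition of the product type and the following multiplication by complex scalars. *)
type_synonym 'v complexified = "'v \<times> 'v"

definition cscale :: "complex \<Rightarrow> 'v::real_vector complexified \<Rightarrow> 'v complexified" where
  "cscale c z = (Re c *\<^sub>R fst z - Im c *\<^sub>R snd z, Re c *\<^sub>R snd z + Im c *\<^sub>R fst z)"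

global_interpretation cplx: vector_space
    "cscale :: complex \<Rightarrow> 'v::real_vector complexified \<Rightarrow> 'v complexified"
  by unfold_locales (auto simp: cscale_def algebra_simps)

definition cbilinear_ext ::
    "('v \<Rightarrow> 'v \<Rightarrow> real) \<Rightarrow> 'v complexified \<Rightarrow> 'v complexified \<Rightarrow> complex" where
  "cbilinear_ext A z w =
     Complex (A (fst z) (fst w) - A (snd z) (snd w)) (A (fst z) (snd w) + A (snd z) (fst w))"

definition clinear_ext :: "('v \<Rightarrow> 'v) \<Rightarrow> 'v complexified \<Rightarrow> 'v complexified" where
  "clinear_ext F z = (F (fst z), F (snd z))"

definition radical :: "('v \<Rightarrow> 'v \<Rightarrow> real) \<Rightarrow> 'v complexified set" where
  "radical A = {z. \<forall>w. cbilinear_ext A z w = 0}"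

definition symplectic_complement ::
    "('v \<Rightarrow> 'v \<Rightarrow> real) \<Rightarrow> 'v complexified set \<Rightarrow> 'v complexified set" where
  "symplectic_complement \<omega> W = {z. \<forall>w\<in>W. cbilinear_ext \<omega> z w = 0}"

definition symplectic_subspace ::
    "('v::real_vector \<Rightarrow> 'v \<Rightarrow> real) \<Rightarrow> 'v complexified set \<Rightarrow> bool" where
  "symplectic_subspace \<omega> W \<longleftrightarrow> cplx.subspace W \<and> W \<inter> symplectic_complement \<omega> W = {0}"

definition eigenvalue :: "('v::real_vector \<Rightarrow> 'v) \<Rightarrow> complex \<Rightarrow> bool" where
  "eigenvalue F \<kappa> \<longleftrightarrow> (\<exists>z. z \<noteq> 0 \<and> clinear_ext F z = cscale \<kappa> z)"

(* The algebraic multiplicity, as the dimension of the generalized eigenspace. *)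
definition multiplicity_of :: "('v::real_vector \<Rightarrow> 'v) \<Rightarrow> complex \<Rightarrow> nat" where
  "multiplicity_of F \<kappa> =
     cplx.dim {z. \<exists>m. ((\<lambda>u. clinear_ext F u - cscale \<kappa> u) ^^ m) z = 0}"

definition pm_imag :: "nat set \<Rightarrow> (nat \<Rightarrow> real) \<Rightarrow> complex multiset" where
  "pm_imag K \<mu> =
     {# \<i> * of_real (\<mu> j). j \<in># mset_set K #} + {# - (\<i> * of_real (\<mu> j)). j \<in># mset_set K #}"

(* The numbers \<plusminus>i \<mu> j for j in K list all the non-zero eigenvalues of F, each repeated according
   to its multiplicity; the remaining \<mu> j vanish. *)
definition lists_nonzero_eigenvalues ::
    "nat \<Rightarrow> ('v::real_vector \<Rightarrow> 'v) \<Rightarrow> nat set \<Rightarrow> (nat \<Rightarrow> real) \<Rightarrow> bool" where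
  "lists_nonzero_eigenvalues n F K \<mu> \<longleftrightarrow>
     K \<subseteq> {1..n} \<and> (\<forall>j\<in>K. \<mu> j > 0) \<and> (\<forall>j\<in>{1..n} - K. \<mu> j = 0) \<and>
     set_mset (pm_imag K \<mu>) = {\<kappa>. eigenvalue F \<kappa> \<and> \<kappa> \<noteq> 0} \<and>
     (\<forall>\<kappa>. eigenvalue F \<kappa> \<and> \<kappa> \<noteq> 0 \<longrightarrow> count (pm_imag K \<mu>) \<kappa> = multiplicity_of F \<kappa>)"

(* The sign in F x = \<mu> y, F y = - \<mu> x is forced by A v w = \<omega> v (F w), \<omega> (x j) (y j) = 1 and
   A (x j) (x j) = \<mu> j.  A single basis in general cannot have the non-zero \<mu> j and the non-zero
   \<gamma> j both occupy initial segments of the indices (take f = s1^2 + t1^2, g = s2^2 + t2^2), so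
   those of \<gamma> are allowed an arbitrary index set L. *)
definition simultaneous_normal_form ::
    "('v::real_vector \<Rightarrow> 'v \<Rightarrow> real) \<Rightarrow> nat \<Rightarrow> ('v \<Rightarrow> 'v) \<Rightarrow> ('v \<Rightarrow> 'v) \<Rightarrow> (nat \<Rightarrow> 'v) \<Rightarrow> (nat \<Rightarrow> 'v)
       \<Rightarrow> nat \<Rightarrow> (nat \<Rightarrow> real) \<Rightarrow> nat set \<Rightarrow> (nat \<Rightarrow> real) \<Rightarrow> bool" where
  "simultaneous_normal_form \<omega> n F G x y k \<mu> L \<gamma> \<longleftrightarrow>
     symplectic_basis \<omega> n x y \<and>
     lists_nonzero_eigenvalues n F {1..k} \<mu> \<and>
     lists_nonzero_eigenvalues n G L \<gamma> \<and>
     (\<forall>j\<in>{1..n}.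
        F (x j) = \<mu> j *\<^sub>R y j \<and> F (y j) = - (\<mu> j *\<^sub>R x j) \<and>
        G (x j) = \<gamma> j *\<^sub>R y j \<and> G (y j) = - (\<gamma> j *\<^sub>R x j))"

end

(* Since X_f = -2 F, the bracket {f, g} vanishes iff F and G commute. In that case put
   H = F + G, the map of f + g. The kernel of H is the common kernel of F and G (both forms are
   semidefinite), so by hypothesis it is symplectic, and symplectic pairs in it can be split off.
   Where f + g is positive definite, F and H are commuting skew maps for the inner product
   A + B: the maximum tau of f / (f + g) is attained on the subspace {F v = tau H v}, which is
   invariant under H, and on it a critical vector v of |H v|^2 / |v|^2 satisfies H^2 v = - nu^2 v.
   Then v and H v, rescaled, form a pair of the basis with parameters tau nu and (1 - tau) nu.
   The symplectic complement of such a pair is invariant under F and G, which allows induction on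
   the dimension. The vectors x_j - i y_j and x_j + i y_j diagonalise F and G over the complex
   numbers, which yields the eigenvalues and their multiplicities. *)
theory Submission
  imports Defs
begin

no_notation vector_scalar_mult (infixl \<open>*s\<close> 70)

section \<open>Extremal vectors of a pair of symmetric forms\<close>

text \<open>Since \<open>N v v = 0\<close>, the value of \<open>N\<close> on the diagonal at
  \<open>w + t *\<^sub>R v\<close> is affine in \<open>t\<close> with slope
  \<open>2 * N v w\<close>, and an affine function that stays nonnegative has slope zero.\<close>

lemma psd_isotropic_null:
  fixes N :: "'v::real_vector \<Rightarrow> 'v \<Rightarrow> real"
  assumes "bilinear N" and sym: "\<And>v w. N v w = N w v" and S: "subspace S"
    and psd: "\<And>v. v \<in> S \<Longrightarrow> N v v \<ge> 0"
    and v: "v \<in> S" "N v v = 0" and w: "w \<in> S"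
  shows "N v w = 0"
proof (rule ccontr)
  assume b: "N v w \<noteq> 0"
  \<comment> \<open>This \<open>t\<close> brings the affine function down to exactly -1.\<close>
  define t where "t = - (N w w + 1) / (2 * N v w)"
  have "w + t *\<^sub>R v \<in> S"
    using S v w by (simp add: subspace_add subspace_scale)
  then have "0 \<le> N (w + t *\<^sub>R v) (w + t *\<^sub>R v)" by (rule psd)
  also have "\<dots> = N w w + 2 * t * N v w"
    using v(2) sym[of w v] \<open>bilinear N\<close>
    by (simp add: bilinear_ladd bilinear_radd bilinear_lmul bilinear_rmul)
  also have "\<dots> = - 1" using b by (simp add: t_def field_simps)
  finally show False by simp
qed

text \<open>A Rayleigh quotient argument: \<open>\<tau>\<close> is the maximum of
  \<open>D v v / C v v\<close> on the unit sphere of \<open>S\<close>. Then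
  \<open>\<tau> * C - D\<close> is semidefinite on \<open>S\<close> and null at a maximiser, so by
  \<open>psd_isotropic_null\<close> the maximiser is null against all of \<open>S\<close>.\<close>

lemma relative_eigenvector:
  fixes C D :: "'v::euclidean_space \<Rightarrow> 'v \<Rightarrow> real"
  assumes C: "bilinear C" "\<And>v w. C v w = C w v"
    and D: "bilinear D" "\<And>v w. D v w = D w v"
    and S: "subspace S" "S \<noteq> {0}"
    and pos: "\<And>v. v \<in> S \<Longrightarrow> v \<noteq> 0 \<Longrightarrow> C v v > 0"
  obtains \<tau> v where "v \<in> S" "v \<noteq> 0" "\<And>w. w \<in> S \<Longrightarrow> D v w = \<tau> * C v w"
proof -
  let ?K = "S \<inter> sphere 0 1"
  have unit: "(1 / norm u) *\<^sub>R u \<in> ?K" if "u \<in> S" "u \<noteq> 0" for u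
    using that S by (simp add: subspace_scale)
  obtain u where "u \<in> S" "u \<noteq> 0" using S subspace_0 by blast
  then have ne: "?K \<noteq> {}" using unit by blast
  have comp: "compact ?K"
    using closed_subspace[OF S(1)] by (simp add: closed_Int_compact)
  have bC: "bounded_bilinear C" and bD: "bounded_bilinear D"
    using C(1) D(1) by (simp_all add: bilinear_conv_bounded_bilinear)
  have "continuous_on ?K (\<lambda>v. D v v / C v v)"
    by (intro continuous_intros bounded_bilinear.continuous_on[OF bC]
        bounded_bilinear.continuous_on[OF bD]) (use pos in force)
  from continuous_attains_sup[OF comp ne this] obtain v where v: "v \<in> ?K"
    and max: "\<And>u. u \<in> ?K \<Longrightarrow> D u u / C u u \<le> D v v / C v v" by blast
  define \<tau> where "\<tau> = D v v / C v v"
  define N where "N = (\<lambda>u w. \<tau> * C u w - D u w)"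
  have v0: "v \<in> S" "v \<noteq> 0" using v by auto
  have "bilinear N"
    using C(1) D(1) unfolding N_def bilinear_def linear_iff by (simp add: algebra_simps)
  moreover have "N u w = N w u" for u w
    unfolding N_def using C(2)[of u w] D(2)[of u w] by simp
  moreover have "N u u \<ge> 0" if u: "u \<in> S" for u
  proof (cases "u = 0")
    case True
    then show ?thesis using \<open>bilinear N\<close> by (simp add: bilinear_lzero)
  next
    case False
    \<comment> \<open>The quotient is homogeneous of degree zero, so the bound on unit vectors
      extends to all non-zero vectors of \<open>S\<close>.\<close>
    have "D u u / C u u \<le> \<tau>"
      using max[OF unit[OF u False]] False C(1) D(1)
      by (simp add: \<tau>_def bilinear_lmul bilinear_rmul)
    then show ?thesis using pos[OF u False] by (simp add: N_def field_simps)
  qed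
  moreover have "N v v = 0" using pos[OF v0] by (simp add: N_def \<tau>_def)
  ultimately have "N v w = 0" if "w \<in> S" for w
    using psd_isotropic_null[of N S v w] S(1) v0(1) that by blast
  then have "D v w = \<tau> * C v w" if "w \<in> S" for w
    using that by (simp add: N_def)
  with that v0 show thesis by blast
qed

section \<open>Independence and diagonal maps over an arbitrary field\<close>

context vector_space
begin

text \<open>\<open>N i\<close> contains the span of all members other than \<open>e i\<close>, but
  not \<open>e i\<close> itself. In the applications, real and complex, \<open>N i\<close> is the
  hyperplane of vectors that pair to zero with the conjugate of \<open>e i\<close> in a symplectic
  basis.\<close>

lemma independent_family_if_separated:
  assumes N: "\<And>i. i \<in> I \<Longrightarrow> subspace (N i)"
    and out: "\<And>i. i \<in> I \<Longrightarrow> e i \<notin> N i"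
    and others: "\<And>i j. i \<in> I \<Longrightarrow> j \<in> I \<Longrightarrow> i \<noteq> j \<Longrightarrow> e j \<in> N i"
  shows "inj_on e I" and "independent (e ` I)"
proof -
  show "inj_on e I"
    using out others unfolding inj_on_def by metis
  show "independent (e ` I)"
  proof
    assume "dependent (e ` I)"
    then obtain i where i: "i \<in> I" "e i \<in> span (e ` I - {e i})"
      by (auto simp: dependent_def)
    have "e ` I - {e i} \<subseteq> N i" using others[OF i(1)] by auto
    from span_minimal[OF this N[OF i(1)]] i out show False by blast
  qed
qed

text \<open>In the basis \<open>e\<close>, the map \<open>T\<close> minus \<open>c\<close>
  multiplies the coordinate at \<open>i\<close> by \<open>\<kappa> i - c\<close>. A power of it
  kills a vector only if the coordinates with \<open>\<kappa> i \<noteq> c\<close> vanish, so the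
  generalized eigenspace is spanned by the remaining \<open>e i\<close>. The locale setting lets
  this be applied to \<open>cscale\<close>.\<close>

lemma diagonal_map:
  assumes T: "module_hom scale scale T"
    and fin: "finite I" and inj: "inj_on e I" and ind: "independent (e ` I)"
    and sp: "span (e ` I) = UNIV"
    and ev: "\<And>i. i \<in> I \<Longrightarrow> T (e i) = \<kappa> i *s e i"
  shows dim_generalized_eigenspace:
      "dim {z. \<exists>m. ((\<lambda>u. T u - c *s u) ^^ m) z = 0} = card {i \<in> I. \<kappa> i = c}"
    and eigenvalue_diagonal_iff:
      "(\<exists>z. z \<noteq> 0 \<and> T z = c *s z) \<longleftrightarrow> (\<exists>i\<in>I. \<kappa> i = c)"
proof -
  interpret T: module_hom scale scale T by (rule T)
  let ?D = "\<lambda>u. T u - c *s u"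
  let ?J = "{i \<in> I. \<kappa> i = c}"
  have pow: "(?D ^^ m) (\<Sum>i\<in>I. a i *s e i) = (\<Sum>i\<in>I. (a i * (\<kappa> i - c) ^ m) *s e i)" for m a
  proof (induction m)
    case (Suc m)
    have "?D (\<Sum>i\<in>I. b i *s e i) = (\<Sum>i\<in>I. (b i * (\<kappa> i - c)) *s e i)" for b
    proof -
      have "?D (\<Sum>i\<in>I. b i *s e i) = (\<Sum>i\<in>I. T (b i *s e i) - c *s (b i *s e i))"
        by (simp add: T.sum scale_sum_right sum_subtractf)
      also have "\<dots> = (\<Sum>i\<in>I. (b i * (\<kappa> i - c)) *s e i)"
        by (intro sum.cong refl)
          (simp add: T.scale ev scale_left_diff_distrib right_diff_distrib mult.commute)
      finally show ?thesis .
    qed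
    then show ?case by (simp add: Suc mult_ac)
  qed simp
  have rep: "\<exists>a. z = (\<Sum>i\<in>I. a i *s e i)" for z
  proof -
    have "z \<in> span (e ` I)" by (simp add: sp)
    then obtain u where "z = (\<Sum>v\<in>e ` I. u v *s v)"
      unfolding span_finite[OF finite_imageI[OF fin]] by blast
    then show ?thesis using inj by (auto simp: sum.reindex intro!: exI[of _ "u \<circ> e"])
  qed
  have zero: "a i = 0" if "(\<Sum>i\<in>I. a i *s e i) = 0" "i \<in> I" for a i
  proof -
    have "(\<Sum>v\<in>e ` I. a (inv_into I e v) *s v) = 0"
      using that(1) inj by (simp add: sum.reindex cong: sum.cong)
    from independentD[OF ind finite_imageI[OF fin] subset_refl this, of "e i"]
    show ?thesis using that(2) inj by simp
  qed
  have gen: "{z. \<exists>m. (?D ^^ m) z = 0} = span (e ` ?J)" (is "?L = ?R")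
  proof
    show "?L \<subseteq> ?R"
    proof
      fix z assume "z \<in> ?L"
      then obtain m where m: "(?D ^^ m) z = 0" by blast
      obtain a where a: "z = (\<Sum>i\<in>I. a i *s e i)" using rep by blast
      have "(\<Sum>i\<in>I. (a i * (\<kappa> i - c) ^ m) *s e i) = 0" using m pow by (simp add: a)
      then have "a i = 0" if "i \<in> I - ?J" for i using zero that by fastforce
      then have "z = (\<Sum>i\<in>?J. a i *s e i)"
        unfolding a by (intro sum.mono_neutral_right) (use fin in auto)
      then show "z \<in> ?R" by (auto intro: span_sum span_scale span_base)
    qed
    show "?R \<subseteq> ?L"
    proof
      fix z assume "z \<in> ?R"
      moreover have "subspace {z. ?D z = 0}"
        by (rule subspaceI) (auto simp: T.add T.scale T.zero algebra_simps)
      then have "?R \<subseteq> {z. ?D z = 0}" by (intro span_minimal) (auto simp: ev)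
      \<comment> \<open>For a diagonal map one power is enough: generalized eigenvectors are
        eigenvectors.\<close>
      ultimately have "(?D ^^ 1) z = 0" by auto
      then show "z \<in> ?L" by blast
    qed
  qed
  have "independent (e ` ?J)" by (rule independent_mono[OF ind]) auto
  then have "dim ?L = card (e ` ?J)" unfolding gen by (rule dim_span_eq_card_independent)
  also have "\<dots> = card ?J" by (intro card_image inj_on_subset[OF inj]) auto
  finally show "dim ?L = card ?J" .
  show "(\<exists>z. z \<noteq> 0 \<and> T z = c *s z) \<longleftrightarrow> (\<exists>i\<in>I. \<kappa> i = c)"
  proof
    assume "\<exists>z. z \<noteq> 0 \<and> T z = c *s z"
    then obtain z where z: "z \<noteq> 0" "(?D ^^ 1) z = 0" by auto
    then have "z \<in> span (e ` ?J)" using gen by blast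
    then have "?J \<noteq> {}" using z(1) span_empty by fastforce
    then show "\<exists>i\<in>I. \<kappa> i = c" by blast
  next
    assume "\<exists>i\<in>I. \<kappa> i = c"
    then obtain i where i: "i \<in> I" "\<kappa> i = c" by blast
    then have "e i \<noteq> 0" using ind dependent_zero by (metis imageI)
    then show "\<exists>z. z \<noteq> 0 \<and> T z = c *s z" using ev i by blast
  qed
qed

end

section \<open>The Poisson bracket of two quadratic forms\<close>

lemma symplectic_form_antisym:
  assumes "symplectic_form \<omega>"
  shows "\<omega> v w = - \<omega> w v"
proof -
  have b: "bilinear \<omega>" and alt: "\<And>x. \<omega> x x = 0"
    using assms by (auto simp: symplectic_form_def)
  have "\<omega> (v + w) (v + w) = \<omega> v w + \<omega> w v"
    unfolding bilinear_ladd[OF b] bilinear_radd[OF b] by (simp add: alt)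
  then show ?thesis by (simp add: alt)
qed

lemma symplectic_form_eq_zero:
  assumes "symplectic_form \<omega>" "\<And>v. \<omega> v u = 0"
  shows "u = 0"
proof -
  have "\<omega> u v = 0" for v
    using symplectic_form_antisym[OF assms(1), of u v] assms(2) by simp
  with assms(1) show ?thesis unfolding symplectic_form_def by blast
qed

text \<open>Symmetry of \<open>A\<close> played against antisymmetry of \<open>\<omega>\<close>: the
  map of a quadratic form lies in the symplectic Lie algebra.\<close>

lemma assoc_linear_map_skew:
  assumes "symplectic_form \<omega>" "assoc_bilinear_form f A" "assoc_linear_map \<omega> A F"
  shows "\<omega> (F v) w = - \<omega> v (F w)"
  using assms symplectic_form_antisym[OF assms(1), of "F v" w]
  unfolding assoc_bilinear_form_def assoc_linear_map_def by metis

text \<open>The differential at \<open>v\<close> is \<open>2 * A v h = 2 * \<omega> h (F v)\<close>,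
  and moving \<open>F v\<close> to the first slot of \<open>\<omega>\<close> produces the minus
  sign.\<close>

lemma hamiltonian_vector_field_quadratic:
  fixes \<omega> :: "'v::euclidean_space \<Rightarrow> 'v \<Rightarrow> real"
  assumes \<omega>: "symplectic_form \<omega>" and f: "assoc_bilinear_form f A"
    and F: "assoc_linear_map \<omega> A F"
  shows "hamiltonian_vector_field \<omega> f v = - 2 *\<^sub>R F v"
proof -
  have A: "bilinear A" "\<And>v w. A v w = A w v" "\<And>v. f v = A v v"
    using f by (auto simp: assoc_bilinear_form_def)
  have b\<omega>: "bilinear \<omega>" using \<omega> by (simp add: symplectic_form_def)
  have bA: "bounded_bilinear A" using A(1) by (simp add: bilinear_conv_bounded_bilinear)
  have "f = (\<lambda>v. A v v)" using A(3) by blast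
  moreover have "((\<lambda>v. A v v) has_derivative (\<lambda>h. A v h + A h v)) (at v)"
    by (rule bounded_bilinear.FDERIV[OF bA has_derivative_ident has_derivative_ident])
  ultimately have "frechet_derivative f (at v) = (\<lambda>h. A v h + A h v)"
    by (metis frechet_derivative_at)
  moreover have "A v h + A h v = \<omega> (- 2 *\<^sub>R F v) h" for h
  proof -
    have "A v h + A h v = 2 * \<omega> h (F v)"
      using A(2)[of v h] F by (simp add: assoc_linear_map_def)
    also have "\<dots> = \<omega> (- 2 *\<^sub>R F v) h"
      using symplectic_form_antisym[OF \<omega>, of h "F v"] by (simp only: bilinear_lmul[OF b\<omega>]) simp
    finally show ?thesis .
  qed
  ultimately have d: "frechet_derivative f (at v) = \<omega> (- 2 *\<^sub>R F v)" by auto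
  \<comment> \<open>The description by \<open>THE\<close> is resolved by nondegeneracy of
    \<open>\<omega>\<close>, which rules out a second vector representing the differential.\<close>
  show ?thesis unfolding hamiltonian_vector_field_def
  proof (rule the_equality)
    fix u assume "\<forall>w. \<omega> u w = frechet_derivative f (at v) w"
    then have "\<forall>w. \<omega> (u - (- 2 *\<^sub>R F v)) w = 0"
      by (simp only: d bilinear_lsub[OF b\<omega>]) simp
    with \<omega> have "u - (- 2 *\<^sub>R F v) = 0" unfolding symplectic_form_def by blast
    then show "u = - 2 *\<^sub>R F v" by (simp only: right_minus_eq)
  qed (simp add: d)
qed

text \<open>The bracket is the quadratic form \<open>4 * \<omega> (F v) (G v)\<close>. Its
  polarisation pairs \<open>v\<close> with the commutator applied to \<open>w\<close>, so
  nondegeneracy of \<open>\<omega>\<close> turns its vanishing into commutation.\<close>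

lemma poisson_commute_iff:
  fixes \<omega> :: "'v::euclidean_space \<Rightarrow> 'v \<Rightarrow> real"
  assumes \<omega>: "symplectic_form \<omega>"
    and f: "assoc_bilinear_form f A" "assoc_linear_map \<omega> A F"
    and g: "assoc_bilinear_form g B" "assoc_linear_map \<omega> B G"
  shows "poisson_bracket \<omega> f g = (\<lambda>_. 0) \<longleftrightarrow> (\<forall>v. F (G v) = G (F v))"
proof -
  have b\<omega>: "bilinear \<omega>" using \<omega> by (simp add: symplectic_form_def)
  have lin: "linear F" "linear G" using f g by (auto simp: assoc_linear_map_def)
  note skF = assoc_linear_map_skew[OF \<omega> f] and skG = assoc_linear_map_skew[OF \<omega> g]
  have pb: "poisson_bracket \<omega> f g v = 4 * \<omega> (F v) (G v)" for v
    by (simp only: poisson_bracket_def hamiltonian_vector_field_quadratic[OF \<omega> f]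
        hamiltonian_vector_field_quadratic[OF \<omega> g] bilinear_lmul[OF b\<omega>] bilinear_rmul[OF b\<omega>]) simp
  \<comment> \<open>By skewness the two cross terms combine into the commutator.\<close>
  have polar: "\<omega> (F (v + w)) (G (v + w)) - \<omega> (F v) (G v) - \<omega> (F w) (G w)
      = \<omega> v (G (F w) - F (G w))" for v w
  proof -
    have "\<omega> (F w) (G v) = \<omega> v (G (F w))"
      using symplectic_form_antisym[OF \<omega>, of "F w" "G v"] skG[of v "F w"] by simp
    then show ?thesis
      by (simp add: lin[THEN linear_add] bilinear_ladd[OF b\<omega>] bilinear_radd[OF b\<omega>]
          bilinear_rsub[OF b\<omega>] skF[of v])
  qed
  show ?thesis
  proof
    assume "poisson_bracket \<omega> f g = (\<lambda>_. 0)"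
    then have "\<omega> (F v) (G v) = 0" for v using pb[of v] by simp
    then have "\<omega> v (G (F w) - F (G w)) = 0" for v w using polar[of v w] by simp
    then have "G (F w) - F (G w) = 0" for w by (rule symplectic_form_eq_zero[OF \<omega>])
    then show "\<forall>v. F (G v) = G (F v)" by simp
  next
    assume comm: "\<forall>v. F (G v) = G (F v)"
    \<comment> \<open>With \<open>w = v\<close> the left side of \<open>polar\<close> is 4 - 1 - 1 =
      2 times \<open>\<omega> (F v) (G v)\<close>.\<close>
    have "\<omega> (F v) (G v) = 0" for v
      using polar[of v v] comm lin
      by (simp add: scaleR_2[symmetric] linear_scale bilinear_lmul[OF b\<omega>] bilinear_rmul[OF b\<omega>] bilinear_rzero[OF b\<omega>])
    then show "poisson_bracket \<omega> f g = (\<lambda>_. 0)" by (auto simp: pb)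
  qed
qed

section \<open>Splitting off common normal pairs\<close>

text \<open>Positivity of \<open>h\<close> makes \<open>C\<close> an inner product on
  \<open>U\<close>, for which \<open>H\<close> is skew. A first Rayleigh quotient fixes the ratio
  \<open>\<tau>\<close> of \<open>F\<close> to \<open>H\<close>. Commutation makes the space
  \<open>E\<close> of that ratio stable under \<open>H\<close>, so a second quotient can be taken
  inside \<open>E\<close>.\<close>

lemma common_eigenvector:
  fixes \<omega> :: "'v::euclidean_space \<Rightarrow> 'v \<Rightarrow> real"
    and U :: "'v set"
  assumes \<omega>: "symplectic_form \<omega>"
    and f: "assoc_bilinear_form f A" "assoc_linear_map \<omega> A F"
    and h: "assoc_bilinear_form h C" "assoc_linear_map \<omega> C H"
    and comm: "\<And>v. F (H v) = H (F v)"
    and U: "subspace U" "U \<noteq> {0}" "F ` U \<subseteq> U" "H ` U \<subseteq> U"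
    and pos: "\<And>v. v \<in> U \<Longrightarrow> v \<noteq> 0 \<Longrightarrow> h v > 0"
  obtains v \<tau> \<nu> where "v \<in> U" "v \<noteq> 0" "\<nu> > 0" "F v = \<tau> *\<^sub>R H v" "H (H v) = - (\<nu>\<^sup>2 *\<^sub>R v)"
proof -
  have b\<omega>: "bilinear \<omega>" using \<omega> by (simp add: symplectic_form_def)
  have A: "bilinear A" "\<And>v w. A v w = A w v" and C: "bilinear C" "\<And>v w. C v w = C w v"
    and hC: "\<And>v. h v = C v v"
    using f(1) h(1) by (auto simp: assoc_bilinear_form_def)
  have lin: "linear F" "linear H" and AF: "\<And>v w. A v w = \<omega> v (F w)"
    and CH: "\<And>v w. C v w = \<omega> v (H w)"
    using f(2) h(2) by (auto simp: assoc_linear_map_def)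
  note sk = assoc_linear_map_skew[OF \<omega> h]
  have skew: "C (H v) w = - C v (H w)" for v w by (simp add: CH sk)
  have pos_C: "C v v > 0" if "v \<in> U" "v \<noteq> 0" for v using pos[OF that] by (simp add: hC)
  obtain \<tau> v1 where v1: "v1 \<in> U" "v1 \<noteq> 0" and eig: "\<And>w. w \<in> U \<Longrightarrow> A v1 w = \<tau> * C v1 w"
    using relative_eigenvector[OF C A U(1,2) pos_C] by blast
  define E where "E = {v \<in> U. F v = \<tau> *\<^sub>R H v}"
  \<comment> \<open>The relation \<open>eig\<close> can be tested only against \<open>U\<close>.
    This suffices because \<open>C u u = \<omega> u (H u)\<close> with \<open>H u\<close> in
    \<open>U\<close>, so that positivity of \<open>C\<close> makes \<open>\<omega>\<close>
    nondegenerate on \<open>U\<close>.\<close>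
  have "F v1 - \<tau> *\<^sub>R H v1 = 0"
  proof (rule ccontr)
    let ?u = "F v1 - \<tau> *\<^sub>R H v1"
    assume "?u \<noteq> 0"
    moreover have u: "?u \<in> U"
      using U v1 by (intro subspace_diff subspace_scale) auto
    ultimately have "0 < C ?u ?u" using pos by (simp add: hC)
    also have "C ?u ?u = - \<omega> (H ?u) ?u" by (simp add: CH sk)
    also have "\<omega> (H ?u) ?u = A (H ?u) v1 - \<tau> * C (H ?u) v1"
      by (simp add: AF CH bilinear_rsub[OF b\<omega>] bilinear_rmul[OF b\<omega>])
    also have "\<dots> = A v1 (H ?u) - \<tau> * C v1 (H ?u)"
      by (simp only: A(2)[of v1] C(2)[of v1])
    also have "H ?u \<in> U" using u U(4) by blast
    then have "A v1 (H ?u) - \<tau> * C v1 (H ?u) = 0" by (simp add: eig)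
    finally show False by simp
  qed
  then have "v1 \<in> E" using v1 by (simp add: E_def)
  then have E0: "E \<noteq> {0}" using v1(2) by blast
  have E: "subspace E" unfolding E_def subspace_def using U(1) lin
    by (auto simp: subspace_0 subspace_add subspace_scale linear_0 linear_add linear_scale
        scaleR_add_right scaleR_left_commute)
  have HE: "H v \<in> E" if "v \<in> E" for v
    using that U(4) comm lin(2) by (auto simp: E_def linear_scale)
  \<comment> \<open>The squared length of \<open>H v\<close> for the inner product
    \<open>C\<close>.\<close>
  define D where "D = (\<lambda>v w. C (H v) (H w))"
  have "bilinear D"
    using C(1) lin(2) unfolding D_def bilinear_def linear_iff by simp
  moreover have "D v w = D w v" for v w unfolding D_def by (rule C(2))
  moreover have "C v v > 0" if "v \<in> E" "v \<noteq> 0" for v using that pos by (simp add: E_def hC)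
  ultimately obtain \<delta> v where v: "v \<in> E" "v \<noteq> 0" "\<And>w. w \<in> E \<Longrightarrow> D v w = \<delta> * C v w"
    using relative_eigenvector[OF C _ _ E E0, of D] by blast
  have vU: "v \<in> U" using v(1) by (simp add: E_def)
  have "H v \<noteq> 0"
    using pos[OF vU v(2)] by (auto simp: hC CH bilinear_rzero[OF b\<omega>])
  then have "0 < C (H v) (H v)" using pos[of "H v"] U(4) vU by (auto simp: hC)
  then have "0 < \<delta> * C v v" using v(3)[OF v(1)] by (simp add: D_def)
  then have \<delta>: "\<delta> > 0" using pos[OF vU v(2)] by (simp add: hC zero_less_mult_iff)
  \<comment> \<open>By skewness \<open>D v w = - C (H (H v)) w\<close>, so this vector is
    \<open>C\<close>-orthogonal to \<open>E\<close>. It also lies in \<open>E\<close>, hence is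
    orthogonal to itself.\<close>
  have u: "H (H v) + \<delta> *\<^sub>R v \<in> E" (is "?u \<in> E")
    using E HE v(1) by (intro subspace_add subspace_scale) auto
  have "C ?u ?u = 0"
    using v(3)[OF u] skew[of "H v" ?u]
    by (simp only: D_def bilinear_ladd[OF C(1)] bilinear_lmul[OF C(1)]) simp
  then have "?u = 0" using pos[of ?u] u by (auto simp: E_def hC)
  then have "H (H v) = - ((sqrt \<delta>)\<^sup>2 *\<^sub>R v)"
    using \<delta> by (simp add: eq_neg_iff_add_eq_0)
  with that[of v "sqrt \<delta>" \<tau>] v \<delta> vU show thesis by (simp add: E_def)
qed


text \<open>Either \<open>U\<close> meets the common kernel of \<open>F\<close> and
  \<open>G\<close>, where \<open>nondeg\<close> supplies a partner and both parameters are zero, or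
  \<open>f + g\<close> is positive definite on \<open>U\<close> and
  \<open>common_eigenvector\<close> applies to \<open>H = F + G\<close>.\<close>

lemma normal_pair_splitting:
  fixes \<omega> :: "'v::euclidean_space \<Rightarrow> 'v \<Rightarrow> real"
    and U :: "'v set"
  assumes \<omega>: "symplectic_form \<omega>"
    and f: "assoc_bilinear_form f A" "\<And>v. f v \<ge> 0" "assoc_linear_map \<omega> A F"
    and g: "assoc_bilinear_form g B" "\<And>v. g v \<ge> 0" "assoc_linear_map \<omega> B G"
    and comm: "\<And>v. F (G v) = G (F v)"
    and U: "subspace U" "U \<noteq> {0}" "F ` U \<subseteq> U" "G ` U \<subseteq> U"
    and nondeg: "\<And>v. v \<in> U \<Longrightarrow> F v = 0 \<Longrightarrow> G v = 0 \<Longrightarrow> v \<noteq> 0 \<Longrightarrow>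
      \<exists>w\<in>U. F w = 0 \<and> G w = 0 \<and> \<omega> v w \<noteq> 0"
  obtains x y where "x \<in> U" "y \<in> U" "\<omega> x y = 1"
    "F x = f x *\<^sub>R y" "F y = - (f x *\<^sub>R x)" "G x = g x *\<^sub>R y" "G y = - (g x *\<^sub>R x)"
proof -
  have b\<omega>: "bilinear \<omega>" using \<omega> by (simp add: symplectic_form_def)
  have fF: "f v = \<omega> v (F v)" and gG: "g v = \<omega> v (G v)" for v
    using f(1,3) g(1,3) by (auto simp: assoc_bilinear_form_def assoc_linear_map_def)
  have lin: "linear F" "linear G" using f(3) g(3) by (auto simp: assoc_linear_map_def)
  note found = that
  \<comment> \<open>The parameters need not be identified in advance: pairing
    \<open>F x = a *\<^sub>R y\<close> with \<open>x\<close> gives \<open>f x = a\<close>, and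
    likewise for \<open>g\<close>.\<close>
  have suffices: thesis
    if "x \<in> U" "y \<in> U" "\<omega> x y = 1" "F x = a *\<^sub>R y" "F y = - (a *\<^sub>R x)" "G x = b *\<^sub>R y"
      "G y = - (b *\<^sub>R x)" for x y a b
  proof -
    have "f x = a" "g x = b" using that by (simp_all add: fF gG bilinear_rmul[OF b\<omega>])
    with that show thesis by (intro found[of x y]) auto
  qed
  show thesis
  proof (cases "\<exists>x\<in>U. F x = 0 \<and> G x = 0 \<and> x \<noteq> 0")
    case True
    then obtain x w where x: "x \<in> U" "F x = 0" "G x = 0"
      and w: "w \<in> U" "F w = 0" "G w = 0" "\<omega> x w \<noteq> 0" using nondeg by blast
    then show thesis
      using U(1) lin
      by (intro suffices[of x "(1 / \<omega> x w) *\<^sub>R w" 0 0])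
        (simp_all add: subspace_scale linear_scale bilinear_rmul[OF b\<omega>])
  next
    case False
    define H where "H v = F v + G v" for v
    define C where "C v w = A v w + B v w" for v w
    have hC: "assoc_bilinear_form (\<lambda>v. f v + g v) C"
      using f(1) g(1) unfolding assoc_bilinear_form_def bilinear_def linear_iff C_def
      by (simp add: algebra_simps)
    have hH: "assoc_linear_map \<omega> C H"
      using f(3) g(3) unfolding assoc_linear_map_def linear_iff C_def H_def
      by (simp add: bilinear_radd[OF b\<omega>] scaleR_add_right)
    \<comment> \<open>A null vector of a semidefinite form lies in its radical.\<close>
    have null: "F v = 0" if "f v = 0" "assoc_bilinear_form f A" "\<And>v. f v \<ge> 0"
      "assoc_linear_map \<omega> A F" for f A F and v :: 'v
    proof (rule symplectic_form_eq_zero[OF \<omega>])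
      fix w
      have "A v w = 0"
        by (rule psd_isotropic_null[of A UNIV]) (use that in \<open>auto simp: assoc_bilinear_form_def\<close>)
      then show "\<omega> w (F v) = 0"
        using that(2,4) by (metis assoc_bilinear_form_def assoc_linear_map_def)
    qed
    have pos: "f v + g v > 0" if "v \<in> U" "v \<noteq> 0" for v
    proof (rule ccontr)
      assume "\<not> ?thesis"
      then have "f v = 0" "g v = 0" using f(2)[of v] g(2)[of v] by linarith+
      then have "F v = 0" "G v = 0" using null f g by blast+
      with False that show False by blast
    qed
    have "H ` U \<subseteq> U" using U by (auto simp: H_def intro!: subspace_add)
    moreover have "F (H v) = H (F v)" for v
      using comm lin by (simp add: H_def linear_add)
    ultimately obtain v \<tau> \<nu> where v: "v \<in> U" "v \<noteq> 0" and \<nu>: "\<nu> > 0"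
      and Fv: "F v = \<tau> *\<^sub>R H v" and HHv: "H (H v) = - (\<nu>\<^sup>2 *\<^sub>R v)"
      using common_eigenvector[OF \<omega> f(1,3) hC hH _ U(1,2,3) _ pos] by metis
    have linH: "linear H" using hH by (simp add: assoc_linear_map_def)
    have c: "\<omega> v (H v) > 0"
      using pos[OF v] by (simp add: fF gG H_def bilinear_radd[OF b\<omega>])
    \<comment> \<open>Scaled so that \<open>\<omega> x y\<close>, which is
      \<open>a * (a / \<nu>) * \<omega> v (H v)\<close>, becomes 1.\<close>
    define a where "a = sqrt (\<nu> / \<omega> v (H v))"
    have a: "a * a * \<omega> v (H v) = \<nu>" using c \<nu> by (simp add: a_def)
    define x where "x = a *\<^sub>R v"
    define y where "y = (a / \<nu>) *\<^sub>R H v"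
    have Gv: "G v = (1 - \<tau>) *\<^sub>R H v"
      using Fv by (simp add: H_def[of v] algebra_simps)
    have comm': "F (H v) = H (F v)" "G (H v) = H (G v)"
      using comm lin by (simp_all add: H_def linear_add)
    show thesis
    proof (rule suffices[of x y "\<tau> * \<nu>" "(1 - \<tau>) * \<nu>"])
      show "x \<in> U" "y \<in> U" unfolding x_def y_def
        using U(1) v \<open>H ` U \<subseteq> U\<close> by (auto intro!: subspace_scale)
      show "\<omega> x y = 1" unfolding x_def y_def
        using a \<nu> by (simp add: bilinear_lmul[OF b\<omega>] bilinear_rmul[OF b\<omega>])
      show "F x = (\<tau> * \<nu>) *\<^sub>R y" "G x = ((1 - \<tau>) * \<nu>) *\<^sub>R y"
        using \<nu> lin by (simp_all add: x_def y_def linear_scale Fv Gv mult_ac)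
      have "F y = (a / \<nu>) *\<^sub>R (\<tau> *\<^sub>R H (H v))" "G y = (a / \<nu>) *\<^sub>R ((1 - \<tau>) *\<^sub>R H (H v))"
        using lin linH by (simp_all add: y_def linear_scale comm' Fv Gv)
      then show "F y = - ((\<tau> * \<nu>) *\<^sub>R x)" "G y = - (((1 - \<tau>) * \<nu>) *\<^sub>R x)"
        using \<nu> unfolding HHv x_def by (simp_all add: power2_eq_square mult_ac)
    qed
  qed
qed

text \<open>Induction on \<open>dim U\<close>: invariance and nondegeneracy of the common kernel
  both pass to the symplectic complement of a normal pair. The pairs form a set, so no numbering is
  carried along; it is chosen at the end. Independence is recovered later from the pairing
  relations.\<close>

lemma normal_pairs_exist:
  fixes \<omega> :: "'v::euclidean_space \<Rightarrow> 'v \<Rightarrow> real"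
    and U :: "'v set"
  assumes \<omega>: "symplectic_form \<omega>"
    and f: "assoc_bilinear_form f A" "\<And>v. f v \<ge> 0" "assoc_linear_map \<omega> A F"
    and g: "assoc_bilinear_form g B" "\<And>v. g v \<ge> 0" "assoc_linear_map \<omega> B G"
    and comm: "\<And>v. F (G v) = G (F v)"
    and "subspace U" "F ` U \<subseteq> U" "G ` U \<subseteq> U"
    and "\<forall>v\<in>U. F v = 0 \<longrightarrow> G v = 0 \<longrightarrow> v \<noteq> 0 \<longrightarrow>
      (\<exists>w\<in>U. F w = 0 \<and> G w = 0 \<and> \<omega> v w \<noteq> 0)"
  shows "\<exists>P. finite P \<and> P \<subseteq> U \<times> U \<and> U \<subseteq> span (fst ` P \<union> snd ` P) \<and>
    (\<forall>(x, y)\<in>P. \<omega> x y = 1 \<and> F x = f x *\<^sub>R y \<and> F y = - (f x *\<^sub>R x) \<and>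
       G x = g x *\<^sub>R y \<and> G y = - (g x *\<^sub>R x)) \<and>
    (\<forall>p\<in>P. \<forall>q\<in>P. p \<noteq> q \<longrightarrow>
       \<omega> (fst p) (snd q) = 0 \<and> \<omega> (fst p) (fst q) = 0 \<and> \<omega> (snd p) (snd q) = 0)"
  using assms(9-12)
proof (induction "dim U" arbitrary: U rule: less_induct)
  case less
  show ?case
  proof (cases "U = {0}")
    case True
    then show ?thesis by (intro exI[of _ "{}"]) auto
  next
    case False
    have b\<omega>: "bilinear \<omega>" and alt: "\<And>v. \<omega> v v = 0"
      using \<omega> by (auto simp: symplectic_form_def)
    note anti = symplectic_form_antisym[OF \<omega>]
    note skF = assoc_linear_map_skew[OF \<omega> f(1,3)] and skG = assoc_linear_map_skew[OF \<omega> g(1,3)]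
    have lin: "linear F" "linear G" using f(3) g(3) by (auto simp: assoc_linear_map_def)
    note bl = bilinear_ladd[OF b\<omega>] bilinear_radd[OF b\<omega>] bilinear_lmul[OF b\<omega>]
      bilinear_rmul[OF b\<omega>] bilinear_lneg[OF b\<omega>] bilinear_rneg[OF b\<omega>]
      bilinear_lsub[OF b\<omega>] bilinear_rsub[OF b\<omega>] bilinear_rzero[OF b\<omega>] bilinear_lzero[OF b\<omega>]
    obtain x y where xy: "x \<in> U" "y \<in> U" "\<omega> x y = 1"
      and F: "F x = f x *\<^sub>R y" "F y = - (f x *\<^sub>R x)"
      and G: "G x = g x *\<^sub>R y" "G y = - (g x *\<^sub>R x)"
      using normal_pair_splitting[OF \<omega> f g comm less.prems(1) False less.prems(2,3)] less.prems(4)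
      by blast
    have yx: "\<omega> y x = - 1" using anti[of y x] xy(3) by simp
    define U' where "U' = {v \<in> U. \<omega> x v = 0 \<and> \<omega> y v = 0}"
    \<comment> \<open>The projection onto the symplectic complement \<open>U'\<close> along the
      plane of \<open>x\<close> and \<open>y\<close>.\<close>
    define proj where "proj v = v - (\<omega> v y *\<^sub>R x - \<omega> v x *\<^sub>R y)" for v
    have proj: "proj v \<in> U'" if "v \<in> U" for v
    proof -
      have "proj v \<in> U" unfolding proj_def
        using that xy less.prems(1) by (intro subspace_diff subspace_scale) auto
      then show ?thesis
        by (simp add: U'_def proj_def bl alt xy(3) yx anti[of v x] anti[of v y])
    qed
    have sub: "subspace U'"
      using less.prems(1) unfolding subspace_def U'_def by (simp add: bl)
    have "x \<notin> U'" using yx by (simp add: U'_def)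
    then have "U' \<subset> U" using xy(1) by (auto simp: U'_def)
    then have dim: "dim U' < dim U"
      using less.prems(1) sub by (metis dim_psubset span_eq_iff)
    \<comment> \<open>Skewness moves \<open>F\<close> and \<open>G\<close> onto \<open>x\<close> and
      \<open>y\<close>, which they send to multiples of each other; hence \<open>U'\<close> is
      invariant.\<close>
    have "\<omega> x (F v) = - (f x * \<omega> y v)" "\<omega> y (F v) = f x * \<omega> x v"
      "\<omega> x (G v) = - (g x * \<omega> y v)" "\<omega> y (G v) = g x * \<omega> x v" for v
      using skF[of x v] skF[of y v] skG[of x v] skG[of y v] by (simp_all add: F G bl)
    then have inv: "F ` U' \<subseteq> U'" "G ` U' \<subseteq> U'"
      using less.prems(2,3) by (auto simp: U'_def)
    have nondeg: "\<forall>v\<in>U'. F v = 0 \<longrightarrow> G v = 0 \<longrightarrow> v \<noteq> 0 \<longrightarrow>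
      (\<exists>w\<in>U'. F w = 0 \<and> G w = 0 \<and> \<omega> v w \<noteq> 0)"
    proof (intro ballI impI)
      fix v assume v: "v \<in> U'" "F v = 0" "G v = 0" "v \<noteq> 0"
      \<comment> \<open>The partner \<open>w\<close> need not lie in \<open>U'\<close>, but
        \<open>proj w\<close> does, and it has the same pairing with \<open>v\<close>.\<close>
      obtain w where w: "w \<in> U" "F w = 0" "G w = 0" "\<omega> v w \<noteq> 0"
        using less.prems(4) v by (auto simp: U'_def)
      \<comment> \<open>Since \<open>F\<close> and \<open>G\<close> kill \<open>w\<close>, skewness
        shows that they kill its component in the plane as well, so \<open>proj w\<close> stays in
        the common kernel.\<close>
      have "f x * \<omega> w y = 0" "f x * \<omega> w x = 0" "g x * \<omega> w y = 0" "g x * \<omega> w x = 0"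
        using skF[of w x] skF[of w y] skG[of w x] skG[of w y] by (simp_all add: w F G bl)
      then have "F (proj w) = 0" "G (proj w) = 0"
        using lin by (auto simp: proj_def linear_diff linear_scale w F G)
      moreover have "\<omega> v (proj w) = \<omega> v w"
        using v(1) anti[of v x] anti[of v y] by (simp add: U'_def proj_def bl)
      ultimately show "\<exists>w\<in>U'. F w = 0 \<and> G w = 0 \<and> \<omega> v w \<noteq> 0"
        using proj[OF w(1)] w(4) by (intro bexI[of _ "proj w"]) auto
    qed
    from less.hyps[OF dim sub inv nondeg] obtain P where P: "finite P" "P \<subseteq> U' \<times> U'" "U' \<subseteq> span (fst ` P \<union> snd ` P)"
      and pairs: "\<forall>(x, y)\<in>P. \<omega> x y = 1 \<and> F x = f x *\<^sub>R y \<and> F y = - (f x *\<^sub>R x) \<and>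
       G x = g x *\<^sub>R y \<and> G y = - (g x *\<^sub>R x)"
      and orth: "\<forall>p\<in>P. \<forall>q\<in>P. p \<noteq> q \<longrightarrow>
       \<omega> (fst p) (snd q) = 0 \<and> \<omega> (fst p) (fst q) = 0 \<and> \<omega> (snd p) (snd q) = 0"
      by (elim exE conjE) (rule that)
    have new: "\<omega> x (fst p) = 0" "\<omega> x (snd p) = 0" "\<omega> y (fst p) = 0" "\<omega> y (snd p) = 0"
      "\<omega> (fst p) x = 0" "\<omega> (snd p) x = 0" "\<omega> (fst p) y = 0" "\<omega> (snd p) y = 0" if "p \<in> P" for p
    proof -
      have "fst p \<in> U'" "snd p \<in> U'" using that P(2) by auto
      then show "\<omega> x (fst p) = 0" "\<omega> x (snd p) = 0" "\<omega> y (fst p) = 0" "\<omega> y (snd p) = 0"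
        "\<omega> (fst p) x = 0" "\<omega> (snd p) x = 0" "\<omega> (fst p) y = 0" "\<omega> (snd p) y = 0"
        using anti[of _ x] anti[of _ y] by (auto simp: U'_def)
    qed
    let ?P = "insert (x, y) P"
    let ?S = "fst ` ?P \<union> snd ` ?P"
    have "v \<in> span ?S" if "v \<in> U" for v
    proof -
      have "proj v \<in> span ?S"
        using proj[OF that] P(3) span_mono[of "fst ` P \<union> snd ` P" ?S] by blast
      moreover have "\<omega> v y *\<^sub>R x - \<omega> v x *\<^sub>R y \<in> span ?S"
        by (intro span_diff span_scale span_base) auto
      ultimately have "proj v + (\<omega> v y *\<^sub>R x - \<omega> v x *\<^sub>R y) \<in> span ?S" by (rule span_add)
      then show ?thesis by (simp add: proj_def)
    qed
    moreover have "?P \<subseteq> U \<times> U" using P(2) xy by (auto simp: U'_def)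
    moreover have "\<forall>(x, y)\<in>?P. \<omega> x y = 1 \<and> F x = f x *\<^sub>R y \<and> F y = - (f x *\<^sub>R x) \<and>
       G x = g x *\<^sub>R y \<and> G y = - (g x *\<^sub>R x)"
      using pairs xy F G by auto
    moreover have "\<forall>p\<in>?P. \<forall>q\<in>?P. p \<noteq> q \<longrightarrow>
       \<omega> (fst p) (snd q) = 0 \<and> \<omega> (fst p) (fst q) = 0 \<and> \<omega> (snd p) (snd q) = 0"
      using orth new by auto
    ultimately show ?thesis using P(1) by (intro exI[of _ ?P]) auto
  qed
qed


section \<open>Eigenvalues and coordinates in a normal basis\<close>

text \<open>Each vector pairs non-trivially with its own partner only. Indexing by \<open>I\<close>
  times a Boolean lets injectivity of \<open>e\<close> yield the count as well.\<close>

lemma symplectic_family_independent: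
  assumes \<omega>: "symplectic_form \<omega>" and fin: "finite I"
    and one: "\<And>i. i \<in> I \<Longrightarrow> \<omega> (x i) (y i) = 1"
    and orth: "\<And>i j. i \<in> I \<Longrightarrow> j \<in> I \<Longrightarrow> i \<noteq> j \<Longrightarrow>
      \<omega> (x i) (y j) = 0 \<and> \<omega> (x i) (x j) = 0 \<and> \<omega> (y i) (y j) = 0"
  shows "card (x ` I \<union> y ` I) = 2 * card I" and "independent (x ` I \<union> y ` I)"
proof -
  have b\<omega>: "bilinear \<omega>" and alt: "\<And>v. \<omega> v v = 0"
    using \<omega> by (auto simp: symplectic_form_def)
  define e where "e = (\<lambda>(i, s). if s then x i else y i)"
  define N where "N = (\<lambda>(i, s). {v. \<omega> v (e (i, \<not> s)) = 0})"
  have "subspace (N p)" for p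
    by (cases p) (simp add: N_def subspace_def bilinear_lzero[OF b\<omega>] bilinear_ladd[OF b\<omega>]
        bilinear_lmul[OF b\<omega>])
  moreover have yx: "\<omega> (y i) (x j) = - \<omega> (x j) (y i)" for i j
    by (rule symplectic_form_antisym[OF \<omega>])
  have "e p \<notin> N p" if "p \<in> I \<times> UNIV" for p
    using that one by (auto simp: e_def N_def yx split: if_splits)
  moreover have "e q \<in> N p" if "p \<in> I \<times> UNIV" "q \<in> I \<times> UNIV" "p \<noteq> q" for p q
  proof -
    obtain i s j t where pq: "p = (i, s)" "q = (j, t)" by (metis surj_pair)
    show ?thesis
    proof (cases "i = j")
      case True
      then show ?thesis using that by (auto simp: pq N_def alt)
    next
      case False
      then show ?thesis
        using that orth[of i j] orth[of j i] by (cases s; cases t) (auto simp: pq e_def N_def yx)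
    qed
  qed
  ultimately have ie: "inj_on e (I \<times> UNIV)" "independent (e ` (I \<times> UNIV))"
    using real_vector.independent_family_if_separated[of "I \<times> UNIV" N e] by blast+
  have im: "e ` (I \<times> UNIV) = x ` I \<union> y ` I"
    by (auto simp: e_def image_def UNIV_bool)
  show "card (x ` I \<union> y ` I) = 2 * card I"
    using card_image[OF ie(1)] by (simp add: im card_cartesian_product)
  show "independent (x ` I \<union> y ` I)" using ie(2) by (simp add: im)
qed

lemma count_image_mset_set:
  assumes "finite K"
  shows "count {# h j. j \<in># mset_set K #} c = card {j \<in> K. h j = c}"
proof -
  have "h -` {c} \<inter> K = {j \<in> K. h j = c}" by auto
  then show ?thesis using assms by (simp add: count_image_mset)
qed

text \<open>Over the complex numbers \<open>F\<close> is diagonal in the vectors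
  \<open>x j - \<i> y j\<close> and \<open>x j + \<i> y j\<close>, with eigenvalues
  \<open>\<i> \<mu> j\<close> and \<open>- \<i> \<mu> j\<close>, so \<open>diagonal_map\<close>
  applies. An arbitrary \<open>K\<close> serves both \<open>F\<close> and \<open>G\<close>.\<close>

lemma lists_nonzero_eigenvalues_normal_basis:
  fixes \<omega> :: "'v::real_vector \<Rightarrow> 'v \<Rightarrow> real"
  assumes \<omega>: "symplectic_form \<omega>" and basis: "symplectic_basis \<omega> n x y"
    and lin: "linear F" and K: "K \<subseteq> {1..n}" and pos: "\<And>j. j \<in> K \<Longrightarrow> \<mu> j > 0"
    and zero: "\<And>j. j \<in> {1..n} - K \<Longrightarrow> \<mu> j = 0"
    and F: "\<And>j. j \<in> {1..n} \<Longrightarrow> F (x j) = \<mu> j *\<^sub>R y j \<and> F (y j) = - (\<mu> j *\<^sub>R x j)"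
  shows "lists_nonzero_eigenvalues n F K \<mu>"
proof -
  have b\<omega>: "bilinear \<omega>" and alt: "\<And>v. \<omega> v v = 0"
    using \<omega> by (auto simp: symplectic_form_def)
  have one: "\<omega> (x j) (y j) = 1" if "j \<in> {1..n}" for j
    using basis that by (simp add: symplectic_basis_def)
  have orth: "\<omega> (x i) (y j) = 0" "\<omega> (x i) (x j) = 0" "\<omega> (y i) (y j) = 0"
    if "i \<in> {1..n}" "j \<in> {1..n}" "i \<noteq> j" for i j
    using basis that by (simp_all add: symplectic_basis_def)
  have sp: "span (x ` {1..n} \<union> y ` {1..n}) = UNIV"
    using basis by (simp add: symplectic_basis_def)
  have yx: "\<omega> (y i) (x j) = - \<omega> (x j) (y i)" for i j
    by (rule symplectic_form_antisym[OF \<omega>])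
  note bl = bilinear_ladd[OF b\<omega>] bilinear_radd[OF b\<omega>] bilinear_lmul[OF b\<omega>]
    bilinear_rmul[OF b\<omega>] bilinear_lneg[OF b\<omega>] bilinear_rneg[OF b\<omega>]
    bilinear_lsub[OF b\<omega>] bilinear_rsub[OF b\<omega>] bilinear_rzero[OF b\<omega>] bilinear_lzero[OF b\<omega>]
  define I :: "(nat \<times> bool) set" where "I = {1..n} \<times> UNIV"
  define e where "e = (\<lambda>(j, s). (x j, if s then - y j else y j))"
  \<comment> \<open>An eigenvector is isotropic and pairs with its complex conjugate to a non-zero
    multiple of \<open>\<i>\<close>, so the conjugate separates it from the others.\<close>
  define N where "N = (\<lambda>(j, s). {z. cbilinear_ext \<omega> z (e (j, \<not> s)) = 0})"
  define \<kappa> where "\<kappa> = (\<lambda>(j, s). (if s then \<i> * of_real (\<mu> j) else - (\<i> * of_real (\<mu> j))))"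
  have fin: "finite I" by (simp add: I_def)
  have "cbilinear_ext \<omega> (cscale c z) w = c * cbilinear_ext \<omega> z w"
    "cbilinear_ext \<omega> (z + z') w = cbilinear_ext \<omega> z w + cbilinear_ext \<omega> z' w"
    "cbilinear_ext \<omega> 0 w = 0" for c z z' w
    by (simp_all add: cbilinear_ext_def cscale_def bl complex_eq_iff algebra_simps)
  then have "cplx.subspace (N p)" for p
    by (cases p) (simp add: N_def cplx.subspace_def)
  moreover have "e p \<notin> N p" if "p \<in> I" for p
    using that one
    by (cases p; cases "snd p") (auto simp: I_def e_def N_def cbilinear_ext_def bl yx complex_eq_iff)
  moreover have "e q \<in> N p" if "p \<in> I" "q \<in> I" "p \<noteq> q" for p q
  proof (cases "fst p = fst q")
    case True
    then show ?thesis using that one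
      by (cases p; cases q) (auto simp: I_def e_def N_def cbilinear_ext_def bl yx alt complex_eq_iff)
  next
    case False
    then show ?thesis using that orth
      by (cases p; cases q) (auto simp: I_def e_def N_def cbilinear_ext_def bl yx complex_eq_iff)
  qed
  ultimately have inj: "inj_on e I" and ind: "cplx.independent (e ` I)"
    using cplx.independent_family_if_separated[of I N e] by blast+
  have "cplx.span (e ` I) = UNIV"
  proof -
    let ?S = "cplx.span (e ` I)"
    \<comment> \<open>Real vectors suffice, since they span the complexification over the complex
      numbers.\<close>
    have real_part: "(a, 0) \<in> ?S" for a
    proof -
      have "cscale (of_real c) (v, 0) = (c *\<^sub>R v, 0)" for c and v :: 'v by (simp add: cscale_def)
      then have "subspace {a. (a, 0) \<in> ?S}"
        using cplx.span_zero[of "e ` I"] cplx.span_add[of "(_, 0)" "e ` I" "(_, 0)"]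
          cplx.span_scale[of "(_, 0)" "e ` I" "of_real _"]
        unfolding subspace_def by (fastforce simp: zero_prod_def)
      moreover have "(x j, 0) \<in> ?S \<and> (y j, 0) \<in> ?S" if "j \<in> {1..n}" for j
      proof -
        have e: "e (j, True) \<in> ?S" "e (j, False) \<in> ?S"
          using that by (auto intro!: cplx.span_base imageI simp: I_def)
        have "cscale (1/2) (e (j, True) + e (j, False)) \<in> ?S"
          "cscale (\<i>/2) (e (j, True) - e (j, False)) \<in> ?S"
          using e by (auto intro: cplx.span_scale cplx.span_add cplx.span_diff)
        moreover have "cscale (1/2) (e (j, True) + e (j, False)) = (x j, 0)"
          "cscale (\<i>/2) (e (j, True) - e (j, False)) = (y j, 0)"
          by (simp_all add: e_def cscale_def scaleR_diff_right scaleR_left_distrib[symmetric])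
        ultimately show ?thesis by simp
      qed
      ultimately have "span (x ` {1..n} \<union> y ` {1..n}) \<subseteq> {a. (a, 0) \<in> ?S}"
        by (intro span_minimal) auto
      then show ?thesis unfolding sp by blast
    qed
    have "z \<in> ?S" for z
    proof -
      have "(fst z, 0) + cscale \<i> (snd z, 0) \<in> ?S"
        by (intro cplx.span_add cplx.span_scale real_part)
      then show ?thesis by (simp add: cscale_def)
    qed
    then show ?thesis by blast
  qed
  moreover have "module_hom cscale cscale (clinear_ext F)"
    using lin by unfold_locales
      (auto simp: clinear_ext_def cscale_def linear_add linear_diff linear_scale)
  moreover have "clinear_ext F (e i) = cscale (\<kappa> i) (e i)" if "i \<in> I" for i
    using that F lin by (auto simp: I_def e_def \<kappa>_def clinear_ext_def cscale_def linear_neg)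
  ultimately have mult: "multiplicity_of F c = card {i \<in> I. \<kappa> i = c}"
    and ev: "eigenvalue F c \<longleftrightarrow> (\<exists>i\<in>I. \<kappa> i = c)" for c
    using cplx.diagonal_map[of "clinear_ext F", OF _ fin inj ind, of \<kappa> c]
    unfolding multiplicity_of_def eigenvalue_def by simp_all
  have finK: "finite K" using K finite_subset by blast
  have count: "count (pm_imag K \<mu>) c = card {i \<in> I. \<kappa> i = c}" if "c \<noteq> 0" for c
  proof -
    \<comment> \<open>Indices outside \<open>K\<close> have \<open>\<mu> j = 0\<close> and cannot
      contribute to a non-zero \<open>c\<close>.\<close>
    have restrict: "{j \<in> K. \<i> * of_real (\<mu> j) = c} = {j \<in> {1..n}. \<i> * of_real (\<mu> j) = c}"
      "{j \<in> K. - (\<i> * of_real (\<mu> j)) = c} = {j \<in> {1..n}. - (\<i> * of_real (\<mu> j)) = c}"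
      using K zero that by fastforce+
    have "{i \<in> I. \<kappa> i = c} = {j \<in> {1..n}. \<i> * of_real (\<mu> j) = c} \<times> {True} \<union>
        {j \<in> {1..n}. - (\<i> * of_real (\<mu> j)) = c} \<times> {False}"
      by (auto simp: I_def \<kappa>_def split: if_splits)
    then have "card {i \<in> I. \<kappa> i = c} = card {j \<in> {1..n}. \<i> * of_real (\<mu> j) = c} +
        card {j \<in> {1..n}. - (\<i> * of_real (\<mu> j)) = c}"
      by (simp add: card_Un_disjoint disjoint_iff)
    then show ?thesis
      by (simp only: pm_imag_def count_union count_image_mset_set[OF finK] restrict)
  qed
  have "c \<in># pm_imag K \<mu> \<longleftrightarrow> eigenvalue F c \<and> c \<noteq> 0" for c
  proof (cases "c = 0")
    \<comment> \<open>Positivity of \<open>\<mu>\<close> on \<open>K\<close> keeps 0 out of the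
      list.\<close>
    case True
    then show ?thesis using pos finK by (fastforce simp: pm_imag_def)
  next
    case False
    have "c \<in># pm_imag K \<mu> \<longleftrightarrow> card {i \<in> I. \<kappa> i = c} \<noteq> 0"
      by (simp only: count[OF False, symmetric] count_eq_zero_iff) simp
    also have "\<dots> \<longleftrightarrow> eigenvalue F c" using fin by (auto simp: ev)
    finally show ?thesis using False by simp
  qed
  then show ?thesis
    using K pos zero count mult unfolding lists_nonzero_eigenvalues_def by auto
qed

lemma quadratic_form_normal_basis:
  assumes \<omega>: "symplectic_form \<omega>" and basis: "symplectic_basis \<omega> n x y"
    and lin: "linear F" and K: "K \<subseteq> {1..n}" and zero: "\<And>j. j \<in> {1..n} - K \<Longrightarrow> \<mu> j = 0"
    and F: "\<And>j. j \<in> {1..n} \<Longrightarrow> F (x j) = \<mu> j *\<^sub>R y j \<and> F (y j) = - (\<mu> j *\<^sub>R x j)"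
    and v: "v = (\<Sum>j=1..n. s j *\<^sub>R x j + t j *\<^sub>R y j)"
  shows "\<omega> v (F v) = (\<Sum>j\<in>K. \<mu> j * ((s j)\<^sup>2 + (t j)\<^sup>2))"
proof -
  have b\<omega>: "bilinear \<omega>" and alt: "\<And>v. \<omega> v v = 0"
    using \<omega> by (auto simp: symplectic_form_def)
  have yx: "\<omega> (y i) (x j) = - \<omega> (x j) (y i)" for i j
    by (rule symplectic_form_antisym[OF \<omega>])
  note bl = bilinear_ladd[OF b\<omega>] bilinear_lmul[OF b\<omega>] bilinear_rmul[OF b\<omega>] bilinear_rsub[OF b\<omega>]
  define u where "u j = s j *\<^sub>R x j + t j *\<^sub>R y j" for j
  define w where "w j = (s j * \<mu> j) *\<^sub>R y j - (t j * \<mu> j) *\<^sub>R x j" for j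
  have Fv: "F v = (\<Sum>j=1..n. w j)"
    unfolding v linear_sum[OF lin]
    by (intro sum.cong refl) (use lin F in \<open>simp add: w_def linear_add linear_scale\<close>)
  \<comment> \<open>Distinct planes are orthogonal for \<open>\<omega>\<close>, so the double sum
    below collapses to its diagonal.\<close>
  have uw: "\<omega> (u i) (w j) = (if i = j then \<mu> j * ((s j)\<^sup>2 + (t j)\<^sup>2) else 0)"
    if "i \<in> {1..n}" "j \<in> {1..n}" for i j
    using basis that unfolding u_def w_def symplectic_basis_def
    by (auto simp: bl alt yx power2_eq_square algebra_simps)
  have "\<omega> v (F v) = (\<Sum>(i, j)\<in>{1..n} \<times> {1..n}. \<omega> (u i) (w j))"
    unfolding Fv unfolding v u_def[symmetric] by (rule bilinear_sum[OF b\<omega>])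
  also have "\<dots> = (\<Sum>i=1..n. \<Sum>j=1..n. if i = j then \<mu> j * ((s j)\<^sup>2 + (t j)\<^sup>2) else 0)"
    unfolding sum.cartesian_product[symmetric] by (intro sum.cong refl uw)
  also have "\<dots> = (\<Sum>j=1..n. \<mu> j * ((s j)\<^sup>2 + (t j)\<^sup>2))" by simp
  also have "\<dots> = (\<Sum>j\<in>K. \<mu> j * ((s j)\<^sup>2 + (t j)\<^sup>2))"
    using K zero by (intro sum.mono_neutral_right) auto
  finally show ?thesis .
qed

section \<open>Numbering the pairs, descent of the radical condition, and the equivalence\<close>

text \<open>Serves to number the pairs so that those with non-zero \<open>f\<close> come first, by
  gluing enumerations of \<open>K\<close> and of \<open>P - K\<close>.\<close>

lemma ex_bij_betw_initial_segment:
  assumes "finite P" "K \<subseteq> P"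
  shows "\<exists>h. bij_betw h {1..card P} P \<and> bij_betw h {1..card K} K"
proof -
  have finK: "finite K" and le: "card K \<le> card P"
    using assms by (auto intro: finite_subset card_mono)
  obtain h1 where h1: "bij_betw h1 {1..card K} K"
    using ex_bij_betw_nat_finite_1[OF finK] by blast
  have "card ({1..card P} - {1..card K}) = card (P - K)"
    using assms finK le by (simp add: card_Diff_subset)
  then obtain h2 where h2: "bij_betw h2 ({1..card P} - {1..card K}) (P - K)"
    using finite_same_card_bij assms(1) by (metis finite_Diff finite_atLeastAtMost)
  let ?h = "\<lambda>i. if i \<in> {1..card K} then h1 i else h2 i"
  have "bij_betw ?h ({1..card K} \<union> ({1..card P} - {1..card K})) (K \<union> (P - K))"
    by (rule bij_betw_disjoint_Un[OF h1 h2]) auto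
  moreover have "{1..card K} \<union> ({1..card P} - {1..card K}) = {1..card P}" "K \<union> (P - K) = P"
    using assms le by auto
  moreover have "bij_betw ?h {1..card K} K"
    using h1 bij_betw_cong[of "{1..card K}" ?h h1 K] by simp
  ultimately show ?thesis by (intro exI[of _ ?h]) simp
qed

text \<open>Brings the complex hypothesis down to the real space. A real \<open>v\<close> pairing to
  zero with the real common kernel pairs to zero with its complexification, so \<open>(v, 0)\<close>
  lies both in the radical intersection and in its symplectic complement.\<close>

lemma radical_inter_nondegenerate:
  fixes \<omega> :: "'v::euclidean_space \<Rightarrow> 'v \<Rightarrow> real"
  assumes \<omega>: "symplectic_form \<omega>"
    and f: "assoc_bilinear_form f A" "assoc_linear_map \<omega> A F"
    and g: "assoc_bilinear_form g B" "assoc_linear_map \<omega> B G"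
    and rad: "symplectic_subspace \<omega> (radical A \<inter> radical B)"
    and v: "F v = 0" "G v = 0" "v \<noteq> 0"
  shows "\<exists>w. F w = 0 \<and> G w = 0 \<and> \<omega> v w \<noteq> 0"
proof (rule ccontr)
  assume neg: "\<not> ?thesis"
  have b\<omega>: "bilinear \<omega>" using \<omega> by (simp add: symplectic_form_def)
  \<comment> \<open>The radical is the complexified kernel; for one inclusion it is enough to test
    against real vectors.\<close>
  have radical: "z \<in> radical A \<longleftrightarrow> F (fst z) = 0 \<and> F (snd z) = 0"
    if f: "assoc_bilinear_form f A" "assoc_linear_map \<omega> A F" for f A F and z :: "'v \<times> 'v"
  proof -
    have AF: "A u w = - \<omega> (F u) w" for u w
      using f(2) assoc_linear_map_skew[OF \<omega> f] by (simp add: assoc_linear_map_def)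
    show ?thesis
    proof
      assume z: "z \<in> radical A"
      have "\<omega> (F (fst z)) w = 0 \<and> \<omega> (F (snd z)) w = 0" for w
      proof -
        have "cbilinear_ext A z (w, 0) = 0" using z by (simp add: radical_def)
        then show ?thesis
          by (simp add: cbilinear_ext_def AF bilinear_rzero[OF b\<omega>] complex_eq_iff)
      qed
      then show "F (fst z) = 0 \<and> F (snd z) = 0" using \<omega> unfolding symplectic_form_def by blast
    next
      assume "F (fst z) = 0 \<and> F (snd z) = 0"
      then show "z \<in> radical A"
        by (simp add: radical_def cbilinear_ext_def AF bilinear_lzero[OF b\<omega>] complex_eq_iff)
    qed
  qed
  have "F 0 = 0" "G 0 = 0" using f(2) g(2) by (auto simp: assoc_linear_map_def linear_0)
  then have "(v, 0) \<in> radical A \<inter> radical B"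
    using v by (simp add: radical[OF f] radical[OF g])
  moreover have "(v, 0) \<in> symplectic_complement \<omega> (radical A \<inter> radical B)"
    using neg by (auto simp: symplectic_complement_def radical[OF f] radical[OF g]
        cbilinear_ext_def complex_eq_iff bilinear_lzero[OF b\<omega>])
  ultimately have "(v, 0) = (0 :: 'v \<times> 'v)" using rad unfolding symplectic_subspace_def by blast
  then show False using v(3) by (simp add: zero_prod_def)
qed

theorem theorem3p4:
  fixes \<omega> A B :: "'v::euclidean_space \<Rightarrow> 'v \<Rightarrow> real"
    and f g :: "'v \<Rightarrow> real"
    and F G :: "'v \<Rightarrow> 'v"
    and n :: nat
  assumes "DIM('v) = 2 * n"
    and "symplectic_form \<omega>"
    and "assoc_bilinear_form f A" and "\<And>v. f v \<ge> 0" and "assoc_linear_map \<omega> A F"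
    and "assoc_bilinear_form g B" and "\<And>v. g v \<ge> 0" and "assoc_linear_map \<omega> B G"
    and "symplectic_subspace \<omega> (radical A \<inter> radical B)"
  shows "(poisson_bracket \<omega> f g = (\<lambda>_. 0) \<longleftrightarrow>
            (\<exists>x y k \<mu> L \<gamma>. simultaneous_normal_form \<omega> n F G x y k \<mu> L \<gamma>)) \<and>
         (\<forall>x y k \<mu> L \<gamma>. simultaneous_normal_form \<omega> n F G x y k \<mu> L \<gamma> \<longrightarrow>
            (\<forall>s t :: nat \<Rightarrow> real.
               f (\<Sum>j=1..n. s j *\<^sub>R x j + t j *\<^sub>R y j) = (\<Sum>j=1..k. \<mu> j * ((s j)\<^sup>2 + (t j)\<^sup>2)) \<and>
               g (\<Sum>j=1..n. s j *\<^sub>R x j + t j *\<^sub>R y j) = (\<Sum>j\<in>L. \<gamma> j * ((s j)\<^sup>2 + (t j)\<^sup>2))))"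
proof -
  note \<omega> = assms(2) and f = assms(3,4,5) and g = assms(6,7,8)
  have lin: "linear F" "linear G" using f(3) g(3) by (auto simp: assoc_linear_map_def)
  have f\<omega>: "f v = \<omega> v (F v)" and g\<omega>: "g v = \<omega> v (G v)" for v
    using f(1,3) g(1,3) by (auto simp: assoc_bilinear_form_def assoc_linear_map_def)
  have coordinates: "f (\<Sum>j=1..n. s j *\<^sub>R x j + t j *\<^sub>R y j) = (\<Sum>j=1..k. \<mu> j * ((s j)\<^sup>2 + (t j)\<^sup>2)) \<and>
      g (\<Sum>j=1..n. s j *\<^sub>R x j + t j *\<^sub>R y j) = (\<Sum>j\<in>L. \<gamma> j * ((s j)\<^sup>2 + (t j)\<^sup>2))"
    if "simultaneous_normal_form \<omega> n F G x y k \<mu> L \<gamma>" for x y k \<mu> L \<gamma> s t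
    using that unfolding simultaneous_normal_form_def lists_nonzero_eigenvalues_def f\<omega> g\<omega>
    by (intro conjI quadratic_form_normal_basis[OF \<omega> _ lin(1)]
        quadratic_form_normal_basis[OF \<omega> _ lin(2)]) auto
  \<comment> \<open>On each plane of the basis \<open>F\<close> and \<open>G\<close> are multiples
    of the same quarter turn, so they commute there.\<close>
  have "F (G v) = G (F v)" if nf: "simultaneous_normal_form \<omega> n F G x y k \<mu> L \<gamma>" for x y k \<mu> L \<gamma> v
  proof (rule linear_eq_on[of "\<lambda>u. F (G u)" "\<lambda>u. G (F u)" v "x ` {1..n} \<union> y ` {1..n}"])
    show "linear (\<lambda>u. F (G u))" "linear (\<lambda>u. G (F u))"
      using lin linear_compose unfolding o_def by blast+
    show "v \<in> span (x ` {1..n} \<union> y ` {1..n})"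
      using nf by (simp add: simultaneous_normal_form_def symplectic_basis_def)
    show "F (G u) = G (F u)" if "u \<in> x ` {1..n} \<union> y ` {1..n}" for u
      using that nf lin
      by (auto simp: simultaneous_normal_form_def linear_scale linear_neg mult_ac)
  qed
  moreover have "\<exists>x y k \<mu> L \<gamma>. simultaneous_normal_form \<omega> n F G x y k \<mu> L \<gamma>"
    if comm: "\<And>v. F (G v) = G (F v)"
  proof -
    have "\<forall>v\<in>UNIV. F v = 0 \<longrightarrow> G v = 0 \<longrightarrow> v \<noteq> 0 \<longrightarrow>
        (\<exists>w\<in>UNIV. F w = 0 \<and> G w = 0 \<and> \<omega> v w \<noteq> 0)"
      using radical_inter_nondegenerate[OF \<omega> f(1,3) g(1,3) assms(9)] by blast
    from normal_pairs_exist[OF \<omega> f g comm subspace_UNIV subset_UNIV subset_UNIV this]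
    obtain P where P: "finite P" "UNIV \<subseteq> span (fst ` P \<union> snd ` P)"
      and pairs: "\<forall>(x, y)\<in>P. \<omega> x y = 1 \<and> F x = f x *\<^sub>R y \<and> F y = - (f x *\<^sub>R x) \<and>
        G x = g x *\<^sub>R y \<and> G y = - (g x *\<^sub>R x)"
      and orth: "\<forall>p\<in>P. \<forall>q\<in>P. p \<noteq> q \<longrightarrow>
        \<omega> (fst p) (snd q) = 0 \<and> \<omega> (fst p) (fst q) = 0 \<and> \<omega> (snd p) (snd q) = 0"
      by (elim exE conjE) (rule that)
    \<comment> \<open>The normal form wants the non-zero parameters of \<open>F\<close> on an
      initial segment, so these pairs are numbered first; \<open>L\<close> later records where those
      of \<open>G\<close> end up.\<close>
    define K where "K = {p \<in> P. f (fst p) \<noteq> 0}"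
    have K: "K \<subseteq> P" by (auto simp: K_def)
    obtain h where h: "bij_betw h {1..card P} P" and hK: "bij_betw h {1..card K} K"
      using ex_bij_betw_initial_segment[OF P(1) K] by blast
    define x where "x = fst \<circ> h"
    define y where "y = snd \<circ> h"
    let ?I = "{1..card P}"
    have hP: "h j \<in> P" if "j \<in> ?I" for j using h that by (rule bij_betwE[THEN bspec])
    have pair: "\<omega> (x j) (y j) = 1" "F (x j) = f (x j) *\<^sub>R y j" "F (y j) = - (f (x j) *\<^sub>R x j)"
      "G (x j) = g (x j) *\<^sub>R y j" "G (y j) = - (g (x j) *\<^sub>R x j)" if "j \<in> ?I" for j
      using bspec[OF pairs hP[OF that]] by (auto simp: x_def y_def)
    have dist: "h i \<noteq> h j" if "i \<in> ?I" "j \<in> ?I" "i \<noteq> j" for i j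
      using bij_betw_imp_inj_on[OF h] that by (simp only: inj_on_eq_iff) simp
    have orth': "\<omega> (x i) (y j) = 0 \<and> \<omega> (x i) (x j) = 0 \<and> \<omega> (y i) (y j) = 0"
      if "i \<in> ?I" "j \<in> ?I" "i \<noteq> j" for i j
      using orth hP dist that by (simp add: x_def y_def)
    have indep: "card (x ` ?I \<union> y ` ?I) = 2 * card P" "independent (x ` ?I \<union> y ` ?I)"
      using symplectic_family_independent[of \<omega> ?I x y] \<omega> pair(1) orth' by auto
    have im: "x ` ?I = fst ` P" "y ` ?I = snd ` P"
      by (simp_all only: x_def y_def image_comp[symmetric] bij_betw_imp_surj_on[OF h])
    have sp: "span (x ` ?I \<union> y ` ?I) = UNIV" using P(2) im by auto
    \<comment> \<open>The pairs give an independent spanning set of \<open>2 * card P\<close>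
      vectors, which forces their number to be \<open>n\<close>.\<close>
    have "2 * card P = dim (UNIV :: 'v set)"
      using dim_span_eq_card_independent[OF indep(2)] unfolding sp indep(1) by (rule sym)
    then have n: "card P = n" using assms(1) by simp
    define L where "L = {j \<in> {1..n}. g (x j) \<noteq> 0}"
    have basis: "symplectic_basis \<omega> n x y"
      using indep sp pair(1) orth' unfolding symplectic_basis_def n by auto
    have kn: "{1..card K} \<subseteq> {1..n}" using card_mono[OF P(1) K] n by auto
    \<comment> \<open>The enumeration \<open>h\<close> maps the initial segment onto
      \<open>K\<close>, and its injectivity on all of \<open>{1..n}\<close> keeps other indices out
      of \<open>K\<close>.\<close>
    have mem: "j \<in> {1..card K} \<longleftrightarrow> f (x j) \<noteq> 0" if "j \<in> {1..n}" for j
    proof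
      assume "j \<in> {1..card K}"
      then have "h j \<in> K" using hK by (auto dest: bij_betwE)
      then show "f (x j) \<noteq> 0" by (simp add: K_def x_def)
    next
      assume "f (x j) \<noteq> 0"
      then have "h j \<in> K" using hP that by (simp add: K_def x_def n)
      then obtain i where i: "i \<in> {1..card K}" "h i = h j"
        using bij_betw_imp_surj_on[OF hK] by (metis imageE)
      then have "i = j" using dist that kn n by blast
      then show "j \<in> {1..card K}" using i(1) by simp
    qed
    have "lists_nonzero_eigenvalues n F {1..card K} (\<lambda>j. f (x j))"
    proof (rule lists_nonzero_eigenvalues_normal_basis[OF \<omega> basis lin(1) kn])
      show "f (x j) > 0" if "j \<in> {1..card K}" for j
        using mem[of j] that kn f(2)[of "x j"] by (simp add: less_le subset_iff)
    qed (use mem pair in \<open>auto simp: n\<close>)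
    moreover have "lists_nonzero_eigenvalues n G L (\<lambda>j. g (x j))"
      using pair g(2) unfolding n
      by (intro lists_nonzero_eigenvalues_normal_basis[OF \<omega> basis lin(2)])
        (auto simp: L_def less_le)
    ultimately have "simultaneous_normal_form \<omega> n F G x y (card K) (\<lambda>j. f (x j)) L (\<lambda>j. g (x j))"
      using basis pair unfolding simultaneous_normal_form_def n by blast
    then show ?thesis by blast
  qed
  ultimately show ?thesis
    using coordinates unfolding poisson_commute_iff[OF \<omega> f(1,3) g(1,3)] by blast
qed

end
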